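(* Any (single-round, one-way) randomized protocol for $\textsc{(Many vs One)-Set Disjointness}(m,n)$ with error probability $O(m^{-c})$ requires $\Omega(mn)$ bits of communication if $n\ge c_1\log m$, where $c$ and $c_1$ are large enough constants.
   Context: $\textsc{(Many vs One)-Set Disjointness}(m,n)$: there is a ground set $U$ with $|U|=n$; Alice holds a collection $\mathcal{F}_A$ of $m$ subsets of $U$ and Bob holds a single subset $S_b\subseteq U$. The goal is to determine whether there exists $S_a\in\mathcal{F}_A$ with $S_a\cap S_b=\emptyset$. In the communication model considered, Alice sends a single message (possibly randomized) to Bob, after which Bob must output the answer; the communication is the length of the message in bits. Logarithms are base 2. *)

theory Defs
  imports "HOL-Probability.Probability" "HOL-Library.Extended_Real"
begin

text \<open>The ground set is \<open>{..<n}\<close>.  An instance consists of Alice's collection of \<open>m\<close> (distinct)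
  subsets of it and Bob's single subset.\<close>

definition alice_inputs :: "nat \<Rightarrow> nat \<Rightarrow> nat set set set" where
  "alice_inputs m n = {F. F \<subseteq> Pow {..<n} \<and> card F = m}"

definition bob_inputs :: "nat \<Rightarrow> nat set set" where
  "bob_inputs n = Pow {..<n}"

definition many_vs_one_disj :: "nat set set \<Rightarrow> nat set \<Rightarrow> bool" where
  "many_vs_one_disj F S \<longleftrightarrow> (\<exists>A\<in>F. A \<inter> S = {})"

text \<open>One-way randomized protocols.  The players share a random seed and each has private
  randomness as well; protocols without shared randomness are those with a constant seed.  Seeds are
  natural numbers, which is no restriction on discrete shared randomness since a \<open>pmf\<close> has
  countable support.\<close>

record protocol =
  seed :: "nat pmf"
  alice :: "nat \<Rightarrow> nat set set \<Rightarrow> bool list pmf"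
  bob :: "nat \<Rightarrow> bool list \<Rightarrow> nat set \<Rightarrow> bool pmf"

definition run :: "protocol \<Rightarrow> nat set set \<Rightarrow> nat set \<Rightarrow> bool pmf" where
  "run P F S =
     bind_pmf (seed P) (\<lambda>r. bind_pmf (alice P r F) (\<lambda>msg. bob P r msg S))"

text \<open>Error probability on the worst-case input.\<close>

definition error_at_most :: "nat \<Rightarrow> nat \<Rightarrow> protocol \<Rightarrow> real \<Rightarrow> bool" where
  "error_at_most m n P \<epsilon> \<longleftrightarrow>
     (\<forall>F\<in>alice_inputs m n. \<forall>S\<in>bob_inputs n.
        measure_pmf.prob (run P F S) {b. b \<noteq> many_vs_one_disj F S} \<le> \<epsilon>)"

text \<open>The length of the longest message that Alice sends with positive probability on some input;
  \<open>\<infinity>\<close> if there is no longest one.\<close>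

definition communication :: "nat \<Rightarrow> nat \<Rightarrow> protocol \<Rightarrow> enat" where
  "communication m n P =
     (SUP F\<in>alice_inputs m n. SUP r\<in>set_pmf (seed P). SUP msg\<in>set_pmf (alice P r F).
        enat (length msg))"

end

theory Submission
  imports Defs
begin

text \<open>Reduction from INDEX on \<open>N = \<Omega>(mn)\<close> bits.  With \<open>k = \<lceil>log\<^sub>2 m\<rceil>\<close>, the first \<open>2k\<close> points of the ground
  set carry \<open>m\<close> pairwise incomparable codes \<open>code T\<close>, and the set with code \<open>T\<close> uses the remaining points to store
  an arbitrary bit vector.  Bob reads the bit at position \<open>e\<close> of the set with code \<open>T\<close> by asking for
  a set that avoids both \<open>e\<close> and the complement of \<open>code T\<close>; incomparability rules out every other set.

  For INDEX, fix the seed and Alice's messages by averaging.  If \<open>d(X, msg)\<close> is the expected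
  number of positions at which Bob's answers after reading \<open>msg\<close> disagree with \<open>X\<close>, then the sum of
  \<open>exp (-s d(X, msg))\<close> over all \<open>X\<close> is at most \<open>(1 + exp (-s)) ^ N\<close> for each message, while by convexity the
  sum of \<open>exp (-s d(X, msg X))\<close> is at least \<open>2 ^ N exp (-s \<epsilon> N)\<close>.  Comparing the two bounds the number of
  messages from below by an exponential in \<open>N\<close>, already for \<open>\<epsilon> = 1/4\<close>.\<close>

section \<open>Averaging and exponential-sum inequalities\<close>

lemma pmf_exists_le_expectation:
  fixes f :: "'a \<Rightarrow> real"
  assumes "integrable (measure_pmf p) f"
  shows "\<exists>x\<in>set_pmf p. f x \<le> measure_pmf.expectation p f"
proof (rule ccontr)
  assume "\<not> ?thesis"
  then have "AE x in measure_pmf p. measure_pmf.expectation p f < f x"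
    by (auto simp: AE_measure_pmf_iff)
  from measure_pmf.expectation_greater[OF assms this] show False by simp
qed

text \<open>Jensen's inequality for \<open>exp\<close>, by summing the tangent bound
  \<open>1 + y \<le> exp y\<close> around \<open>a\<close>. As \<open>s\<close> is nonnegative, an
  upper bound on the mean of \<open>d\<close> suffices.\<close>

lemma exp_mean_le_mean_exp:
  fixes d :: "'a \<Rightarrow> real"
  assumes "0 \<le> s" and "(\<Sum>x\<in>A. d x) \<le> real (card A) * a"
  shows "real (card A) * exp (- s * a) \<le> (\<Sum>x\<in>A. exp (- s * d x))"
proof -
  have "s * ((\<Sum>x\<in>A. d x) - real (card A) * a) \<le> 0"
    using assms by (simp add: mult_nonneg_nonpos)
  then have "real (card A) * exp (- s * a)
      \<le> exp (- s * a) * (real (card A) - s * ((\<Sum>x\<in>A. d x) - real (card A) * a))"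
    by (simp add: mult.commute)
  also have "\<dots> = (\<Sum>x\<in>A. exp (- s * a) * (1 + s * (a - d x)))"
    by (simp only: sum_distrib_left[symmetric] sum.distrib sum_subtractf sum_constant)
      (simp add: algebra_simps)
  also have "\<dots> \<le> (\<Sum>x\<in>A. exp (- s * a) * exp (s * (a - d x)))"
    by (intro sum_mono mult_left_mono exp_ge_add_one_self) auto
  also have "\<dots> = (\<Sum>x\<in>A. exp (- s * d x))"
    by (simp add: exp_add[symmetric] algebra_simps)
  finally show ?thesis .
qed

text \<open>The exponential factorises over positions, so the sum over all \<open>X\<close> is a
  product with one factor per position. In the application \<open>p i\<close> is the probability
  that Bob answers \<open>True\<close> at \<open>i\<close>.\<close>

lemma sum_exp_disagreement_le:
  fixes p :: "'a \<Rightarrow> real"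
  assumes "finite I" "0 \<le> s" and p: "\<And>i. i \<in> I \<Longrightarrow> 0 \<le> p i \<and> p i \<le> 1"
  shows "(\<Sum>X\<in>Pow I. exp (- s * (\<Sum>i\<in>I. if i \<in> X then p i else 1 - p i)))
           \<le> (1 + exp (- s)) ^ card I"
proof -
  have "(\<Sum>X\<in>Pow I. exp (- s * (\<Sum>i\<in>I. if i \<in> X then p i else 1 - p i)))
      = (\<Sum>X\<in>Pow I. (\<Prod>i\<in>X. exp (- s * p i)) * (\<Prod>i\<in>I - X. exp (- s * (1 - p i))))"
  proof (rule sum.cong[OF refl])
    fix X assume "X \<in> Pow I"
    then have X: "X \<subseteq> I" "finite X" using assms(1) finite_subset by auto
    have "(\<Sum>i\<in>I. if i \<in> X then p i else 1 - p i) = (\<Sum>i\<in>X. p i) + (\<Sum>i\<in>I - X. 1 - p i)"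
      using sum.subset_diff[OF X(1) assms(1), of "\<lambda>i. if i \<in> X then p i else 1 - p i"]
      by (simp add: add.commute cong: sum.cong_simp)
    then show "exp (- s * (\<Sum>i\<in>I. if i \<in> X then p i else 1 - p i))
        = (\<Prod>i\<in>X. exp (- s * p i)) * (\<Prod>i\<in>I - X. exp (- s * (1 - p i)))"
      using X(2) assms(1)
      by (simp add: exp_sum[symmetric] exp_add[symmetric] sum_distrib_left distrib_left sum_negf)
  qed
  also have "\<dots> = (\<Prod>i\<in>I. exp (- s * p i) + exp (- s * (1 - p i)))"
    by (rule prod_add[OF assms(1), symmetric])
  also have "\<dots> \<le> (\<Prod>i\<in>I. 1 + exp (- s))"
  proof (intro prod_mono conjI)
    fix i assume "i \<in> I"
    \<comment> \<open>Two numbers in [0, 1] with product \<open>exp (- s)\<close> have sum at most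
      \<open>1 + exp (- s)\<close>; deterministic answers are the extreme case.\<close>
    then have "0 \<le> (1 - exp (- s * p i)) * (1 - exp (- s * (1 - p i)))"
      using p \<open>0 \<le> s\<close> by (intro mult_nonneg_nonneg) auto
    also have "exp (- s * p i) * exp (- s * (1 - p i)) = exp (- s)"
      by (simp add: exp_add[symmetric] algebra_simps)
    then have "(1 - exp (- s * p i)) * (1 - exp (- s * (1 - p i)))
        = 1 + exp (- s) - (exp (- s * p i) + exp (- s * (1 - p i)))"
      by (simp add: algebra_simps)
    finally show "exp (- s * p i) + exp (- s * (1 - p i)) \<le> 1 + exp (- s)" by simp
  qed (simp add: add_nonneg_nonneg)
  finally show ?thesis by simp
qed

section \<open>Protocol runs, message counting and the bound for INDEX\<close>

lemma run_error_eq: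
  "measure_pmf.prob (run P F S) {b. b \<noteq> v}
     = measure_pmf.expectation (seed P)
         (\<lambda>r. measure_pmf.expectation (alice P r F) (\<lambda>msg. pmf (bob P r msg S) (\<not> v)))"
proof -
  have "{b. b \<noteq> v} = {\<not> v}" by auto
  then show ?thesis by (simp add: measure_pmf_single run_def pmf_bind)
qed

lemma length_le_communication:
  assumes "communication m n P = enat L" "F \<in> alice_inputs m n"
    "r \<in> set_pmf (seed P)" "msg \<in> set_pmf (alice P r F)"
  shows "length msg \<le> L"
proof -
  have "enat (length msg) \<le> communication m n P"
    unfolding communication_def using assms(2-4) by (meson SUP_upper2 order_refl)
  then show ?thesis using assms(1) by simp
qed

text \<open>Messages may have different lengths and need not be prefix-free, so all strings up to
  the maximal length count; hence the exponent \<open>L + 1\<close>.\<close>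

lemma card_bool_lists_le:
  "finite {w :: bool list. length w \<le> L}" "card {w :: bool list. length w \<le> L} \<le> 2 ^ (L + 1)"
proof -
  show "finite {w :: bool list. length w \<le> L}"
    using finite_lists_length_le[of "UNIV :: bool set" L] by simp
  have "card {w :: bool list. length w \<le> L} = (\<Sum>i\<le>L. 2 ^ i)"
    using card_lists_length_le[of "UNIV :: bool set" L] by simp
  also have "\<dots> \<le> 2 ^ (L + 1)"
    by (induction L) auto
  finally show "card {w :: bool list. length w \<le> L} \<le> 2 ^ (L + 1)" .
qed

lemma index_lower_bound:
  assumes err: "error_at_most m n P \<epsilon>" and comm: "communication m n P = enat L"
    and "finite I" "0 \<le> s"
    and enc: "\<And>X. X \<subseteq> I \<Longrightarrow> enc X \<in> alice_inputs m n"
    and query: "\<And>i. i \<in> I \<Longrightarrow> query i \<in> bob_inputs n"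
    and disj: "\<And>X i. X \<subseteq> I \<Longrightarrow> i \<in> I \<Longrightarrow> many_vs_one_disj (enc X) (query i) \<longleftrightarrow> i \<notin> X"
  shows "2 ^ card I * exp (- s * (real (card I) * \<epsilon>)) \<le> 2 ^ (L + 1) * (1 + exp (- s)) ^ card I"
proof -
  \<comment> \<open>The correct answer to \<open>query i\<close> is \<open>i \<notin> X\<close>, so
    the Boolean \<open>i \<in> X\<close> is the wrong one and \<open>d\<close> is an expected number
    of errors.\<close>
  define d where "d r X msg = (\<Sum>i\<in>I. pmf (bob P r msg (query i)) (i \<in> X))" for r X msg
  define h where "h r X = measure_pmf.expectation (alice P r (enc X)) (d r X)" for r X
  have d_bounds: "0 \<le> d r X msg" "d r X msg \<le> card I" for r X msg
    using sum_mono[of I "\<lambda>i. pmf (bob P r msg (query i)) (i \<in> X)" "\<lambda>_. 1"]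
    by (auto simp: d_def pmf_le_1 intro: sum_nonneg)
  \<comment> \<open>Seeds and messages may have infinite support; boundedness supplies the
    integrability that averaging needs.\<close>
  have d_int: "integrable (measure_pmf p) (d r X)" for p r X
    by (rule measure_pmf.integrable_const_bound[where B = "card I"])
      (use d_bounds in \<open>auto simp: AE_measure_pmf_iff\<close>)
  have inner_int: "integrable (measure_pmf p) (\<lambda>msg. pmf (bob P r msg S) b)" for p r S b
    by (rule measure_pmf.integrable_const_bound[where B = 1]) (auto simp: pmf_le_1)
  have outer_int: "integrable (measure_pmf (seed P))
      (\<lambda>r. measure_pmf.expectation (alice P r F) (\<lambda>msg. pmf (bob P r msg S) b))" for F S b
    by (rule measure_pmf.integrable_const_bound[where B = 1])
      (auto simp: pmf_le_1 integral_nonneg intro!: measure_pmf.integral_le_const inner_int)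
  have h_sum: "h r X = (\<Sum>i\<in>I. measure_pmf.expectation (alice P r (enc X))
      (\<lambda>msg. pmf (bob P r msg (query i)) (i \<in> X)))" for r X
    unfolding h_def d_def by (rule Bochner_Integration.integral_sum) (rule inner_int)
  have h_int: "integrable (measure_pmf (seed P)) (\<lambda>r. h r X)" for X
    unfolding h_sum by (intro Bochner_Integration.integrable_sum outer_int)
  have h_le: "measure_pmf.expectation (seed P) (\<lambda>r. h r X) \<le> real (card I) * \<epsilon>"
    if X: "X \<subseteq> I" for X
  proof -
    have "measure_pmf.expectation (seed P) (\<lambda>r. h r X)
        = (\<Sum>i\<in>I. measure_pmf.prob (run P (enc X) (query i))
             {b. b \<noteq> many_vs_one_disj (enc X) (query i)})"
      unfolding h_sum run_error_eq
      by (subst Bochner_Integration.integral_sum) (auto intro: outer_int simp: disj X)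
    also have "\<dots> \<le> (\<Sum>i\<in>I. \<epsilon>)"
      by (intro sum_mono) (use err enc[OF X] query in \<open>auto simp: error_at_most_def\<close>)
    finally show ?thesis by simp
  qed
  \<comment> \<open>A single seed has to serve all \<open>X\<close> at once, so the error is summed
    over \<open>X\<close> before averaging.\<close>
  have "\<exists>r\<in>set_pmf (seed P). (\<Sum>X\<in>Pow I. h r X)
      \<le> measure_pmf.expectation (seed P) (\<lambda>r. \<Sum>X\<in>Pow I. h r X)"
    by (intro pmf_exists_le_expectation Bochner_Integration.integrable_sum h_int)
  then obtain r where r: "r \<in> set_pmf (seed P)" and
    "(\<Sum>X\<in>Pow I. h r X) \<le> measure_pmf.expectation (seed P) (\<lambda>r. \<Sum>X\<in>Pow I. h r X)"
    by blast
  note this(2)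
  also have "measure_pmf.expectation (seed P) (\<lambda>r. \<Sum>X\<in>Pow I. h r X)
      = (\<Sum>X\<in>Pow I. measure_pmf.expectation (seed P) (\<lambda>r. h r X))"
    by (rule Bochner_Integration.integral_sum) (rule h_int)
  also have "\<dots> \<le> (\<Sum>X\<in>Pow I. real (card I) * \<epsilon>)"
    by (intro sum_mono h_le) auto
  finally have h_total: "(\<Sum>X\<in>Pow I. h r X) \<le> real (card (Pow I)) * (real (card I) * \<epsilon>)"
    by simp
  \<comment> \<open>The message, unlike the seed, may be chosen separately for each
    \<open>X\<close>.\<close>
  have "\<exists>msg\<in>set_pmf (alice P r (enc X)). d r X msg \<le> h r X" for X
    unfolding h_def by (rule pmf_exists_le_expectation) (rule d_int)
  then obtain M where M: "M X \<in> set_pmf (alice P r (enc X))" "d r X (M X) \<le> h r X" for X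
    by metis
  define W where "W = {w :: bool list. length w \<le> L}"
  have M_in: "M X \<in> W" if "X \<subseteq> I" for X
    using length_le_communication[OF comm enc[OF that] r M(1)] by (simp add: W_def)
  have W: "finite W" "real (card W) \<le> 2 ^ (L + 1)"
    using card_bool_lists_le[of L] of_nat_mono[where 'a = real] unfolding W_def by fastforce+
  have ball: "(\<Sum>X\<in>Pow I. exp (- s * d r X w)) \<le> (1 + exp (- s)) ^ card I" for w
  proof -
    have compl: "pmf q False = 1 - pmf q True" for q :: "bool pmf"
      using sum_pmf_eq_1[of "{False, True}" q] by (auto simp: subset_iff eq_diff_eq)
    have "d r X w = (\<Sum>i\<in>I. if i \<in> X then pmf (bob P r w (query i)) True
        else 1 - pmf (bob P r w (query i)) True)" for X
      unfolding d_def by (rule sum.cong) (auto simp: compl)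
    then show ?thesis
      using sum_exp_disagreement_le[OF assms(3,4), of "\<lambda>i. pmf (bob P r w (query i)) True"]
      by (simp add: pmf_le_1)
  qed
  have "2 ^ card I * exp (- s * (real (card I) * \<epsilon>)) \<le> (\<Sum>X\<in>Pow I. exp (- s * d r X (M X)))"
  proof -
    have "(\<Sum>X\<in>Pow I. d r X (M X)) \<le> real (card (Pow I)) * (real (card I) * \<epsilon>)"
      using h_total sum_mono[of "Pow I" "\<lambda>X. d r X (M X)" "h r"] M(2) by fastforce
    from exp_mean_le_mean_exp[OF \<open>0 \<le> s\<close> this] show ?thesis
      using \<open>finite I\<close> by (simp add: card_Pow)
  qed
  \<comment> \<open>Adding the nonnegative terms of all other messages decouples \<open>w\<close>
    from \<open>X\<close>, so \<open>ball\<close> applies after the swap.\<close>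
  also have "\<dots> \<le> (\<Sum>X\<in>Pow I. \<Sum>w\<in>W. exp (- s * d r X w))"
    by (intro sum_mono member_le_sum) (use M_in W in auto)
  also have "\<dots> = (\<Sum>w\<in>W. \<Sum>X\<in>Pow I. exp (- s * d r X w))"
    by (rule sum.swap)
  also have "\<dots> \<le> (\<Sum>w\<in>W. (1 + exp (- s)) ^ card I)"
    by (intro sum_mono ball)
  also have "\<dots> \<le> 2 ^ (L + 1) * (1 + exp (- s)) ^ card I"
    using W(2) by (auto intro!: mult_right_mono zero_le_power add_nonneg_nonneg)
  finally show ?thesis .
qed

text \<open>With \<open>s = ln 4\<close> and error 1/4, each position contributes
  \<open>sqrt 2\<close> on the left of the INDEX bound and 5/4 on the right. The ratio
  \<open>4 / 5 * sqrt 2\<close> exceeds 1 and its eighth power exceeds 2, whence the factor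
  8.\<close>

lemma communication_ge_card_index:
  assumes err: "error_at_most m n P \<epsilon>" and "\<epsilon> \<le> 1 / 4"
    and comm: "communication m n P = enat L" and "finite I"
    and enc: "\<And>X. X \<subseteq> I \<Longrightarrow> enc X \<in> alice_inputs m n"
    and query: "\<And>i. i \<in> I \<Longrightarrow> query i \<in> bob_inputs n"
    and disj: "\<And>X i. X \<subseteq> I \<Longrightarrow> i \<in> I \<Longrightarrow> many_vs_one_disj (enc X) (query i) \<longleftrightarrow> i \<notin> X"
  shows "card I \<le> 8 * (L + 1)"
proof -
  let ?N = "card I"
  have "exp (- ln 4 * (real ?N * (1 / 4))) \<le> exp (- ln 4 * (real ?N * \<epsilon>))"
    unfolding exp_le_cancel_iff using \<open>\<epsilon> \<le> 1 / 4\<close>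
    by (intro mult_left_mono_neg mult_left_mono) auto
  then have "2 ^ ?N * exp (- ln 4 * (real ?N * (1 / 4))) \<le> 2 ^ (L + 1) * (1 + exp (- ln 4)) ^ ?N"
    using index_lower_bound[OF err comm \<open>finite I\<close> _ enc query disj, of "ln 4"]
    by (smt (verit) ln_ge_zero mult_left_mono zero_le_power)
  moreover have "exp (- ln (4 :: real)) = 1 / 4"
    by (simp add: exp_minus)
  moreover have "exp (- ln 4 * (real ?N * (1 / 4))) = (1 / sqrt 2) ^ ?N"
  proof -
    have "ln (4 :: real) = 4 * ln (sqrt 2)"
      using ln_realpow[of "2 :: real" 2] by (simp add: ln_sqrt)
    then have "- ln 4 * (real ?N * (1 / 4)) = real ?N * ln (1 / sqrt 2)"
      by (simp add: ln_div)
    then show ?thesis by (simp add: exp_of_nat_mult)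
  qed
  ultimately have "2 ^ ?N * (1 / sqrt 2) ^ ?N \<le> 2 ^ (L + 1) * (5 / 4 :: real) ^ ?N"
    by simp
  then have "(2 * (1 / sqrt 2) / (5 / 4)) ^ ?N \<le> (2 :: real) ^ (L + 1)"
    unfolding power_divide[of _ "5 / 4"] power_mult_distrib[of 2]
    by (subst pos_divide_le_eq) simp_all
  then have "(4 / 5 * sqrt 2) ^ ?N \<le> (2 :: real) ^ (L + 1)"
    by (simp add: real_div_sqrt mult.commute)
  then have "((4 / 5 * sqrt 2) ^ ?N) ^ 8 \<le> ((2 :: real) ^ (L + 1)) ^ 8"
    by (rule power_mono) simp
  then have "((4 / 5 * sqrt 2) ^ 8) ^ ?N \<le> (2 :: real) ^ (8 * (L + 1))"
    by (simp only: power_mult[symmetric] mult.commute)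
  moreover have "(2 :: real) \<le> (4 / 5 * sqrt 2) ^ 8"
  proof -
    have "sqrt 2 ^ 8 = (sqrt 2 ^ 2) ^ 4" by (simp only: power_mult[symmetric]) simp
    then show ?thesis by (simp add: power_mult_distrib power_divide)
  qed
  then have "(2 :: real) ^ ?N \<le> ((4 / 5 * sqrt 2) ^ 8) ^ ?N"
    by (rule power_mono) simp
  ultimately have "(2 :: real) ^ ?N \<le> 2 ^ (8 * (L + 1))" by linarith
  then show ?thesis by simp
qed

section \<open>Encoding INDEX as set disjointness\<close>

definition code :: "nat \<Rightarrow> nat set \<Rightarrow> nat set" where
  "code k T = T \<union> (+) k ` ({..<k} - T)"

lemma code_subset: "T \<subseteq> {..<k} \<Longrightarrow> code k T \<subseteq> {..<2 * k}"
  by (auto simp: code_def)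

text \<open>The low half of an inclusion gives \<open>S \<subseteq> T\<close>; the high half,
  holding shifted complements, gives the converse.\<close>

lemma code_incomparable:
  assumes "S \<subseteq> {..<k}" "T \<subseteq> {..<k}" "code k S \<subseteq> code k T"
  shows "S = T"
proof -
  have low: "x \<in> code k R \<longleftrightarrow> x \<in> R" if "x < k" for x R
    using that by (auto simp: code_def)
  have high: "k + x \<in> code k R \<longleftrightarrow> x < k \<and> x \<notin> R" if "R \<subseteq> {..<k}" for x R
    using that by (auto simp: code_def)
  show ?thesis
  proof (intro equalityI subsetI)
    show "x \<in> T" if "x \<in> S" for x
      using that assms low[of x S] low[of x T] by auto
    show "x \<in> S" if "x \<in> T" for x
      using that assms high[OF assms(1), of x] high[OF assms(2), of x] by auto
  qed
qed

text \<open>\<open>X\<close> is a bit matrix written as a relation, with rows labelled by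
  \<open>W\<close> and the stored points as columns.\<close>

definition enc_family :: "nat \<Rightarrow> nat set set \<Rightarrow> (nat set \<times> nat) set \<Rightarrow> nat set set" where
  "enc_family k W X = (\<lambda>T. code k T \<union> X `` {T}) ` W"

definition index_query :: "nat \<Rightarrow> nat set \<times> nat \<Rightarrow> nat set" where
  "index_query k = (\<lambda>(T, e). insert e ({..<2 * k} - code k T))"

lemma enc_set_low:
  assumes "T \<subseteq> {..<k}" "X \<subseteq> W \<times> {2 * k..<n}"
  shows "(code k T \<union> X `` {T}) \<inter> {..<2 * k} = code k T"
  using code_subset[OF assms(1)] assms(2) by auto

text \<open>Alice needs exactly \<open>m\<close> distinct sets: the codes keep them apart even when
  rows of \<open>X\<close> coincide.\<close>

lemma enc_family_in_alice_inputs: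
  assumes W: "W \<subseteq> Pow {..<k}" "card W = m" and "2 * k \<le> n"
    and X: "X \<subseteq> W \<times> {2 * k..<n}"
  shows "enc_family k W X \<in> alice_inputs m n"
proof -
  have "inj_on (\<lambda>T. code k T \<union> X `` {T}) W"
  proof (rule inj_onI)
    fix S T assume "S \<in> W" "T \<in> W" "code k S \<union> X `` {S} = code k T \<union> X `` {T}"
    then have "code k S = code k T" using enc_set_low[OF _ X] W(1) by (metis PowD subsetD)
    then show "S = T" using code_incomparable \<open>S \<in> W\<close> \<open>T \<in> W\<close> W(1) by blast
  qed
  moreover have "enc_family k W X \<subseteq> Pow {..<n}"
  proof -
    have "code k T \<union> X `` {T} \<subseteq> {..<n}" if "T \<in> W" for T
    proof -
      have "code k T \<subseteq> {..<2 * k}" using that W(1) by (intro code_subset) auto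
      also have "\<dots> \<subseteq> {..<n}" using \<open>2 * k \<le> n\<close> by auto
      finally show ?thesis using X by auto
    qed
    then show ?thesis unfolding enc_family_def by blast
  qed
  ultimately show ?thesis
    using W(2) by (simp add: alice_inputs_def enc_family_def card_image)
qed

lemma index_query_in_bob_inputs:
  "2 * k \<le> n \<Longrightarrow> i \<in> W \<times> {2 * k..<n} \<Longrightarrow> index_query k i \<in> bob_inputs n"
  by (auto simp: index_query_def bob_inputs_def)

lemma enc_family_disj_index_query:
  assumes W: "W \<subseteq> Pow {..<k}" and X: "X \<subseteq> W \<times> {2 * k..<n}" and i: "i \<in> W \<times> {2 * k..<n}"
  shows "many_vs_one_disj (enc_family k W X) (index_query k i) \<longleftrightarrow> i \<notin> X"
proof -
  obtain T e where i_eq: "i = (T, e)" and T: "T \<in> W" "T \<subseteq> {..<k}" and e: "2 * k \<le> e"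
    using i W by auto
  have "(code k S \<union> X `` {S}) \<inter> index_query k i = {} \<longleftrightarrow> S = T \<and> i \<notin> X" if "S \<in> W" for S
  proof -
    have S: "S \<subseteq> {..<k}" using that W by auto
    have "(code k S \<union> X `` {S}) \<inter> index_query k i = {}
        \<longleftrightarrow> e \<notin> code k S \<union> X `` {S} \<and> (code k S \<union> X `` {S}) \<inter> {..<2 * k} \<subseteq> code k T"
      by (auto simp: index_query_def i_eq)
    \<comment> \<open>\<open>e\<close> lies beyond every code, and the part of the set below
      \<open>2 * k\<close> is exactly its code.\<close>
    also have "\<dots> \<longleftrightarrow> e \<notin> X `` {S} \<and> code k S \<subseteq> code k T"
      using e code_subset[OF S] by (subst enc_set_low[OF S X]) auto
    also have "\<dots> \<longleftrightarrow> S = T \<and> i \<notin> X"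
      using code_incomparable[OF S T(2)] by (auto simp: i_eq)
    finally show ?thesis .
  qed
  then show ?thesis
    using T(1) by (auto simp: many_vs_one_disj_def enc_family_def)
qed

text \<open>Any \<open>m\<close> subsets of \<open>{..<k}\<close> can label the rows, and each row
  stores \<open>n - 2 * k\<close> bits.\<close>

lemma communication_lower_bound:
  assumes err: "error_at_most m n P \<epsilon>" and "\<epsilon> \<le> 1 / 4"
    and comm: "communication m n P = enat L"
    and "m \<le> 2 ^ k" "2 * k \<le> n"
  shows "m * (n - 2 * k) \<le> 8 * (L + 1)"
proof -
  obtain W where W: "W \<subseteq> Pow {..<k}" "card W = m"
    using obtain_subset_with_card_n[of m "Pow {..<k}"] \<open>m \<le> 2 ^ k\<close> by (auto simp: card_Pow)
  have "finite W" using W(1) by (rule finite_subset) simp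
  then have "finite (W \<times> {2 * k..<n})" by simp
  then have "card (W \<times> {2 * k..<n}) \<le> 8 * (L + 1)"
    using enc_family_in_alice_inputs[OF W \<open>2 * k \<le> n\<close>]
      index_query_in_bob_inputs[OF \<open>2 * k \<le> n\<close>] enc_family_disj_index_query[OF W(1)]
    by (rule communication_ge_card_index[OF err \<open>\<epsilon> \<le> 1 / 4\<close> comm])
  then show ?thesis using W(2) by (simp add: card_cartesian_product)
qed

section \<open>Choice of the constants\<close>

theorem theorem3p2:
  "\<exists>c0 > 0 :: real. \<exists>c1_0 > 0 :: real. \<forall>c \<ge> c0. \<forall>c1 \<ge> c1_0.
     \<forall>K > 0 :: real. \<exists>\<delta> > 0 :: real. \<exists>m0 :: nat.
       \<forall>m \<ge> m0. \<forall>n :: nat. real n \<ge> c1 * log 2 (real m) \<longrightarrow>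
         (\<forall>P :: protocol. error_at_most m n P (K * real m powr (- c)) \<longrightarrow>
            ereal (\<delta> * real m * real n) \<le> ereal_of_enat (communication m n P))"
proof -
  have main: "ereal (1 / 32 * real m * real n) \<le> ereal_of_enat (communication m n P)"
    if c: "1 \<le> c" and c1: "8 \<le> c1" and K: "0 < K" and m: "nat \<lceil>4 * K\<rceil> + 32 \<le> m"
      and n: "c1 * log 2 (real m) \<le> real n"
      and err: "error_at_most m n P (K * real m powr (- c))"
    for c c1 K :: real and m n P
  proof (cases "communication m n P")
    case (enat L)
    have m_ge: "4 * K \<le> real m" "32 \<le> real m" using m by linarith+
    have "K * real m powr (- c) \<le> K * real m powr (- 1)"
      using m_ge c K by (intro mult_left_mono powr_mono) auto
    also have "\<dots> \<le> 1 / 4"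
      using m_ge by (simp add: powr_minus field_simps)
    finally have \<epsilon>: "K * real m powr (- c) \<le> 1 / 4" .
    have log_ge: "1 \<le> log 2 (real m)" using m_ge by simp
    define k where "k = nat \<lceil>log 2 (real m)\<rceil>"
    have "real m = 2 powr log 2 (real m)" using m_ge by simp
    also have "\<dots> \<le> 2 powr real k"
      unfolding k_def by (rule powr_mono) (use log_ge in linarith)+
    finally have "real m \<le> real (2 ^ k)" by (simp add: powr_realpow)
    then have m_le: "m \<le> 2 ^ k" by (simp only: of_nat_le_iff)
    \<comment> \<open>Rounding up costs at most 1, hence at most another \<open>log 2 m\<close>.
      With \<open>c1 \<ge> 8\<close> the codes then occupy at most half of the ground set.\<close>
    have "real k \<le> 2 * log 2 (real m)" unfolding k_def using log_ge by linarith
    moreover have "8 * log 2 (real m) \<le> real n"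
      using n mult_right_mono[OF c1, of "log 2 (real m)"] log_ge by linarith
    ultimately have k_le: "4 * k \<le> n" and n_pos: "8 \<le> real n" using log_ge by linarith+
    have "m * (n - 2 * k) \<le> 8 * (L + 1)"
      using communication_lower_bound[OF err \<epsilon> enat m_le] k_le by simp
    then have "real (m * (n - 2 * k)) \<le> real (8 * (L + 1))"
      by (simp only: of_nat_le_iff)
    then have "real m * real (n - 2 * k) \<le> 8 * (real L + 1)"
      by (simp only: of_nat_mult of_nat_add of_nat_1 of_nat_numeral)
    moreover have "real m * (real n / 2) \<le> real m * real (n - 2 * k)"
      using k_le by (intro mult_left_mono) auto
    ultimately have "real m * real n \<le> 16 * (real L + 1)" by simp
    \<comment> \<open>This absorbs the additive 16 into half of \<open>m * n\<close>, turning 1/16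
      into 1/32.\<close>
    moreover have "32 * 8 \<le> real m * real n"
      using m_ge n_pos by (intro mult_mono) auto
    ultimately have "real m * real n \<le> 32 * real L" by simp
    then show ?thesis by (simp add: enat)
  \<comment> \<open>Without a longest message the communication is infinite and the bound is
    trivial.\<close>
  qed simp
  show ?thesis
  proof (rule exI[of _ 1], intro conjI zero_less_one, rule exI[of _ 8], intro conjI allI impI)
    fix c c1 K :: real
    assume "1 \<le> c" "8 \<le> c1" "0 < K"
    note main' = main[OF this]
    show "\<exists>\<delta>>0. \<exists>m0. \<forall>m\<ge>m0. \<forall>n. c1 * log 2 (real m) \<le> real n \<longrightarrow>
        (\<forall>P. error_at_most m n P (K * real m powr - c) \<longrightarrow>
          ereal (\<delta> * real m * real n) \<le> ereal_of_enat (communication m n P))"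
      by (rule exI[of _ "1 / 32"], intro conjI exI[of _ "nat \<lceil>4 * K\<rceil> + 32"])
        (simp, blast intro: main')
  qed simp
qed

end
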